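(* Let $G$ be a connected bicyclic graph on $n$ vertices with star-expansion $\mathbf{X}_G=\sum_{\lambda\vdash n}c_\lambda\,\mathfrak{st}_\lambda$. \begin{enumerate} \item If $G$ is a type-I bicyclic graph formed by cycles of length $s,t\ge3$, then $c_{(n)}=(s-1)(t-1)$. \item If $G$ is a type-II bicyclic graph formed by two cycles of length $s,t\ge3$ which meet along a path $P_{\ell+1}$ for $\ell\ge1$, then \[c_{(n)}=(s-1)(t-1)-2\binom{\ell}{2}.\] \end{enumerate}
   Context: All graphs are finite and simple. The chromatic symmetric function of a graph $G$ with vertices $v_1,\dots,v_n$ is $\mathbf{X}_G=\sum_\kappa x_{\kappa(v_1)}\cdots x_{\kappa(v_n)}$, summed over all proper colorings $\kappa:V(G)\to\mathbb{N}$. The star graph $\mathsf{St}_k$ on $k$ vertices is the tree with one central vertex adjacent to $k-1$ leaves ($\mathsf{St}_1$ is a single vertex); $\mathfrak{st}_k:=\mathbf{X}_{\mathsf{St}_k}$, and for a partition $\lambda=(\lambda_1,\dots,\lambda_\ell)$, $\mathfrak{st}_\lambda:=\mathfrak{st}_{\lambda_1}\cdots\mathfrak{st}_{\lambda_\ell}$. The set $\{\mathfrak{st}_\lambda:\lambda\vdash n\}$ is a $\mathbb{Q}$-basis (the star-basis) of the space of homogeneous symmetric functions of degree $n$, so $\mathbf{X}_G=\sum_{\lambda\vdash n}c_\lambda\mathfrak{st}_\lambda$ with uniquely determined coefficients $c_\lambda$. A bicyclic graph is a simple connected graph whose number of edges equals its number of vertices plus one. $P_h$ denotes the path on $h$ vertices.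 Every bicyclic graph $G$ has a unique minimal bicyclic subgraph $\tilde G$, of one of two forms. Type-I: $\tilde G$ consists of two cycles $C_s$ and $C_t$ joined by a path $P_h$, $h\ge1$, from a vertex of $C_s$ to a vertex of $C_t$ (the end vertices of the path being these cycle vertices; for $h=1$ the two cycles share a single vertex). Type-II: $\tilde G$ is formed from three paths $P_{k+1},P_{\ell+1},P_{m+1}$ with $k,\ell,m\ge1$, at most one of them equal to $1$, by identifying all initial vertices to one vertex $u$ and all terminal vertices to one vertex $v$ (otherwise disjoint); equivalently, $\tilde G$ consists of two cycles of lengths $s=\ell+k$ and $t=\ell+m$ meeting along the common path $P_{\ell+1}$, which has $\ell$ edges. $G$ is called type-I or type-II according to $\tilde G$. *)

theory Defs
  imports Complex_Main "HOL-Library.Multiset" "HOL-Library.FuncSet"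
begin

section \<open>Finite simple graphs\<close>

record 'a ugraph =
  verts :: "'a set"
  edges :: "'a set set"

definition simple_graph :: "'a ugraph \<Rightarrow> bool" where
  "simple_graph G \<longleftrightarrow> finite (verts G) \<and> (\<forall>e\<in>edges G. e \<subseteq> verts G \<and> card e = 2)"

definition connected_graph :: "'a ugraph \<Rightarrow> bool" where
  "connected_graph G \<longleftrightarrow> verts G \<noteq> {} \<and>
     (\<forall>u\<in>verts G. \<forall>v\<in>verts G. (u, v) \<in> {(x, y). {x, y} \<in> edges G}\<^sup>*)"

definition subgraph :: "'a ugraph \<Rightarrow> 'a ugraph \<Rightarrow> bool" where
  "subgraph H G \<longleftrightarrow> verts H \<subseteq> verts G \<and> edges H \<subseteq> edges G"

definition graph_union :: "'a ugraph \<Rightarrow> 'a ugraph \<Rightarrow> 'a ugraph" where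
  "graph_union G H = \<lparr>verts = verts G \<union> verts H, edges = edges G \<union> edges H\<rparr>"

text \<open>The path and the cycle through the vertices of a list, in that order. They are the
  graphs $P_h$ and $C_s$ when the list is distinct of length $h \ge 1$, respectively
  $s \ge 3$.\<close>

definition path_graph :: "'a list \<Rightarrow> 'a ugraph" where
  "path_graph xs = \<lparr>verts = set xs, edges = {{xs ! i, xs ! Suc i} | i. Suc i < length xs}\<rparr>"

definition cycle_graph :: "'a list \<Rightarrow> 'a ugraph" where
  "cycle_graph xs =
     \<lparr>verts = set xs, edges = {{xs ! i, xs ! (Suc i mod length xs)} | i. i < length xs}\<rparr>"

definition star_graph :: "nat \<Rightarrow> nat ugraph" where
  "star_graph k = \<lparr>verts = {0..<k}, edges = {{0, i} | i. 1 \<le> i \<and> i < k}\<rparr>"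


section \<open>Bicyclic graphs\<close>

definition bicyclic :: "'a ugraph \<Rightarrow> bool" where
  "bicyclic G \<longleftrightarrow>
     simple_graph G \<and> connected_graph G \<and> card (edges G) = card (verts G) + 1"

definition minimal_bicyclic_subgraph :: "'a ugraph \<Rightarrow> 'a ugraph \<Rightarrow> bool" where
  "minimal_bicyclic_subgraph H G \<longleftrightarrow>
     subgraph H G \<and> bicyclic H \<and> (\<forall>K. subgraph K H \<and> bicyclic K \<longrightarrow> K = H)"

definition type_I_form :: "'a ugraph \<Rightarrow> nat \<Rightarrow> nat \<Rightarrow> bool" where
  "type_I_form H s t \<longleftrightarrow> s \<ge> 3 \<and> t \<ge> 3 \<and>
     (\<exists>cs ct ps.
        distinct cs \<and> length cs = s \<and>
        distinct ct \<and> length ct = t \<and>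
        distinct ps \<and> length ps \<ge> 1 \<and>
        set cs \<inter> set ps = {hd ps} \<and>
        set ct \<inter> set ps = {last ps} \<and>
        set cs \<inter> set ct = (if length ps = 1 then {hd ps} else {}) \<and>
        H = graph_union (graph_union (cycle_graph cs) (cycle_graph ct)) (path_graph ps))"

definition type_II_form :: "'a ugraph \<Rightarrow> nat \<Rightarrow> nat \<Rightarrow> nat \<Rightarrow> bool" where
  "type_II_form H k l m \<longleftrightarrow>
     k \<ge> 1 \<and> l \<ge> 1 \<and> m \<ge> 1 \<and>
     \<not> (k = 1 \<and> l = 1) \<and> \<not> (k = 1 \<and> m = 1) \<and> \<not> (l = 1 \<and> m = 1) \<and>
     (\<exists>u v ps qs rs.
        distinct ps \<and> length ps = k + 1 \<and> hd ps = u \<and> last ps = v \<and>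
        distinct qs \<and> length qs = l + 1 \<and> hd qs = u \<and> last qs = v \<and>
        distinct rs \<and> length rs = m + 1 \<and> hd rs = u \<and> last rs = v \<and>
        set ps \<inter> set qs = {u, v} \<and> set ps \<inter> set rs = {u, v} \<and> set qs \<inter> set rs = {u, v} \<and>
        H = graph_union (graph_union (path_graph ps) (path_graph qs)) (path_graph rs))"

definition type_I :: "'a ugraph \<Rightarrow> nat \<Rightarrow> nat \<Rightarrow> bool" where
  "type_I G s t \<longleftrightarrow> (\<exists>H. minimal_bicyclic_subgraph H G \<and> type_I_form H s t)"

text \<open>\<open>type_II G s t l\<close>: the two cycles have lengths \<open>s\<close> and \<open>t\<close>, and the common path
  has \<open>l\<close> edges. Any of the three paths of a type-II graph may play the role of the common path.\<close>

definition type_II :: "'a ugraph \<Rightarrow> nat \<Rightarrow> nat \<Rightarrow> nat \<Rightarrow> bool" where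
  "type_II G s t l \<longleftrightarrow>
     (\<exists>H k m. minimal_bicyclic_subgraph H G \<and> type_II_form H k l m \<and> s = l + k \<and> t = l + m)"


section \<open>Formal power series in countably many variables\<close>

text \<open>A monomial in the variables $x_0, x_1, \dots$ is the multiset of the indices of its
  variables; a power series is the function giving the coefficient of each monomial.\<close>

type_synonym mseries = "nat multiset \<Rightarrow> rat"

definition mseries_one :: mseries where
  "mseries_one M = (if M = {#} then 1 else 0)"

definition mseries_mult :: "mseries \<Rightarrow> mseries \<Rightarrow> mseries" where
  "mseries_mult f g M = (\<Sum>A | A \<subseteq># M. f A * g (M - A))"

lemma finite_submultisets: "finite {A. A \<subseteq># M}"
proof (rule finite_subset)
  show "{A. A \<subseteq># M} \<subseteq> mset ` {xs. set xs \<subseteq> set_mset M \<and> length xs \<le> size M}"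
  proof
    fix A assume "A \<in> {A. A \<subseteq># M}"
    moreover obtain xs where "mset xs = A"
      using ex_mset by blast
    ultimately show "A \<in> mset ` {xs. set xs \<subseteq> set_mset M \<and> length xs \<le> size M}"
      using set_mset_mono[of A M] size_mset_mono[of A M] by (auto intro!: imageI)
  qed
  show "finite (mset ` {xs. set xs \<subseteq> set_mset M \<and> length xs \<le> size M})"
    by (intro finite_imageI finite_lists_length_le) simp
qed


section \<open>Chromatic symmetric functions and the star-basis\<close>

text \<open>Colourings are made extensional outside the vertex set so that each map on the
  vertices is counted once.\<close>

definition proper_colorings :: "'a ugraph \<Rightarrow> ('a \<Rightarrow> nat) set" where
  "proper_colorings G =
     {\<kappa> \<in> verts G \<rightarrow>\<^sub>E UNIV. \<forall>u v. {u, v} \<in> edges G \<longrightarrow> \<kappa> u \<noteq> \<kappa> v}"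

definition chromatic_symmetric_function :: "'a ugraph \<Rightarrow> mseries" where
  "chromatic_symmetric_function G M =
     of_nat (card {\<kappa> \<in> proper_colorings G. image_mset \<kappa> (mset_set (verts G)) = M})"

lemma finite_colorings_with_content:
  assumes "finite (verts G)"
  shows "finite {\<kappa> \<in> proper_colorings G. image_mset \<kappa> (mset_set (verts G)) = M}"
proof (rule finite_subset)
  show "{\<kappa> \<in> proper_colorings G. image_mset \<kappa> (mset_set (verts G)) = M}
          \<subseteq> verts G \<rightarrow>\<^sub>E set_mset M"
    using assms by (auto simp: proper_colorings_def PiE_def)
  show "finite (verts G \<rightarrow>\<^sub>E set_mset M)"
    using assms by (intro finite_PiE) auto
qed

text \<open>Integer partitions of \<open>n\<close> as weakly decreasing lists of positive parts.\<close>

definition partitions :: "nat \<Rightarrow> nat list set" where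
  "partitions n = {\<mu>. sorted_wrt (\<ge>) \<mu> \<and> 0 \<notin> set \<mu> \<and> sum_list \<mu> = n}"

lemma length_le_sum_list:
  "0 \<notin> set xs \<Longrightarrow> length xs \<le> sum_list xs" for xs :: "nat list"
  by (induction xs) auto

lemma finite_partitions: "finite (partitions n)"
proof (rule finite_subset)
  show "partitions n \<subseteq> {xs. set xs \<subseteq> {..n} \<and> length xs \<le> n}"
    using length_le_sum_list by (auto simp: partitions_def intro: member_le_sum_list)
  show "finite {xs. set xs \<subseteq> {..n} \<and> length xs \<le> n}"
    by (rule finite_lists_length_le) simp
qed

definition star_sf :: "nat \<Rightarrow> mseries" where
  "star_sf k = chromatic_symmetric_function (star_graph k)"

definition star_sf_partition :: "nat list \<Rightarrow> mseries" where
  "star_sf_partition \<mu> = foldr mseries_mult (map star_sf \<mu>) mseries_one"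

end

theory Submission
  imports Defs "HOL-Computational_Algebra.Polynomial"
begin

text \<open>Setting \<open>k\<close> variables to 1 and the others to 0 turns $X_G$ into the number of proper
  \<open>k\<close>-colourings of \<open>G\<close>. The star on \<open>m\<close> vertices becomes $k (k-1)^{m-1}$, so a product of at
  least two star functions is divisible by $k^2$, and $(-1)^{n-1} c_{(n)}$ is the linear coefficient
  of the chromatic polynomial. Up to this sign, pendant vertices do not change the linear coefficient, so
  \<open>G\<close> may be replaced by its minimal bicyclic subgraph, which is built from a vertex by attaching
  paths and ears. The effect of an ear is controlled by also counting the colourings in which two
  vertices are forced to share a colour.\<close>

section \<open>Linear coefficients of polynomial functions on the naturals\<close>

text \<open>Factoring out \<open>k\<close> builds in a zero constant term, so
  \<open>poly p 0\<close> is the coefficient of the linear term.\<close>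

definition has_lincoeff :: "(nat \<Rightarrow> rat) \<Rightarrow> rat \<Rightarrow> bool" where
  "has_lincoeff f a \<longleftrightarrow> (\<exists>p. (\<forall>k. f k = of_nat k * poly p (of_nat k)) \<and> poly p 0 = a)"

text \<open>Two candidate cofactors agree at every positive integer, where the factor
  \<open>k\<close> cancels, so their difference has infinitely many roots.\<close>

lemma has_lincoeff_unique:
  assumes "has_lincoeff f a" "has_lincoeff f b"
  shows "a = b"
proof -
  obtain p where p: "\<And>k. f k = of_nat k * poly p (of_nat k)" "poly p 0 = a"
    using assms(1) unfolding has_lincoeff_def by auto
  obtain q where q: "\<And>k. f k = of_nat k * poly q (of_nat k)" "poly q 0 = b"
    using assms(2) unfolding has_lincoeff_def by auto
  have "(of_nat ` {0<..} :: rat set) \<subseteq> {x. poly (p - q) x = 0}"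
  proof
    fix x :: rat assume "x \<in> of_nat ` {0<..}"
    then obtain k :: nat where k: "k > 0" "x = of_nat k" by auto
    have "of_nat k * poly p x = of_nat k * poly q x" using p(1)[of k] q(1)[of k] k by simp
    then show "x \<in> {x. poly (p - q) x = 0}" using k by simp
  qed
  moreover have "infinite (of_nat ` {0<..} :: rat set)"
    by (simp add: finite_image_iff inj_on_def infinite_Ioi)
  ultimately have "infinite {x. poly (p - q) x = 0}"
    using finite_subset by blast
  then have "p - q = 0" using poly_roots_finite by blast
  then show ?thesis using p q by simp
qed

lemma has_lincoeff_add:
  assumes "has_lincoeff f a" "has_lincoeff g b"
  shows "has_lincoeff (\<lambda>k. f k + g k) (a + b)"
  using assms unfolding has_lincoeff_def
  by (metis (no_types, lifting) poly_add distrib_left)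

lemma has_lincoeff_cmult:
  assumes "has_lincoeff f a"
  shows "has_lincoeff (\<lambda>k. c * f k) (c * a)"
  using assms unfolding has_lincoeff_def
  by (metis (no_types, lifting) poly_smult mult.left_commute)

lemma has_lincoeff_diff:
  assumes "has_lincoeff f a" "has_lincoeff g b"
  shows "has_lincoeff (\<lambda>k. f k - g k) (a - b)"
  using has_lincoeff_add[OF assms(1) has_lincoeff_cmult[OF assms(2), of "-1"]] by simp

lemma has_lincoeff_zero: "has_lincoeff (\<lambda>k. 0) 0"
  unfolding has_lincoeff_def by (intro exI[of _ 0]) simp

lemma has_lincoeff_sum:
  assumes "\<And>i. i \<in> I \<Longrightarrow> has_lincoeff (f i) (a i)"
  shows "has_lincoeff (\<lambda>k. \<Sum>i\<in>I. f i k) (\<Sum>i\<in>I. a i)"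
proof (cases "finite I")
  case True
  then show ?thesis using assms
    by (induction I) (auto intro: has_lincoeff_add has_lincoeff_zero)
qed (simp add: has_lincoeff_zero)

text \<open>Each factor contributes one factor \<open>k\<close>, so the product is divisible by the
  square of \<open>k\<close>.\<close>

lemma has_lincoeff_mult:
  assumes "has_lincoeff f a" "has_lincoeff g b"
  shows "has_lincoeff (\<lambda>k. f k * g k) 0"
proof -
  obtain p where p: "\<And>k. f k = of_nat k * poly p (of_nat k)"
    using assms(1) unfolding has_lincoeff_def by auto
  obtain q where q: "\<And>k. g k = of_nat k * poly q (of_nat k)"
    using assms(2) unfolding has_lincoeff_def by auto
  show ?thesis unfolding has_lincoeff_def
    by (intro exI[of _ "[:0, 1:] * p * q"]) (simp add: p q)
qed

lemma has_lincoeff_pred_mult: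
  assumes "has_lincoeff f a"
  shows "has_lincoeff (\<lambda>k. (of_nat k - 1) * f k) (- a)"
proof -
  obtain p where p: "\<And>k. f k = of_nat k * poly p (of_nat k)" "poly p 0 = a"
    using assms(1) unfolding has_lincoeff_def by auto
  show ?thesis unfolding has_lincoeff_def
    by (intro exI[of _ "[:-1, 1:] * p"]) (simp add: p algebra_simps)
qed


section \<open>Colourings with identified vertices\<close>

text \<open>Pairs in \<open>R\<close> stand for contracted vertices. The vertex and edge sets stay
  unchanged, so no quotient graph has to be formed.\<close>

definition colorings :: "nat \<Rightarrow> 'a set \<Rightarrow> 'a set set \<Rightarrow> ('a \<times> 'a) set \<Rightarrow> ('a \<Rightarrow> nat) set" where
  "colorings k V E R =
     {\<kappa> \<in> V \<rightarrow>\<^sub>E {..<k}. (\<forall>u v. {u, v} \<in> E \<longrightarrow> \<kappa> u \<noteq> \<kappa> v) \<and> (\<forall>(x, y) \<in> R. \<kappa> x = \<kappa> y)}"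

lemma finite_colorings: "finite V \<Longrightarrow> finite (colorings k V E R)"
  unfolding colorings_def by (rule finite_subset[of _ "V \<rightarrow>\<^sub>E {..<k}"]) (auto intro: finite_PiE)

lemma colorings_insert_edge:
  "colorings k V (insert {x, y} E) R = {\<kappa> \<in> colorings k V E R. \<kappa> x \<noteq> \<kappa> y}"
  unfolding colorings_def by (auto simp: doubleton_eq_iff)

lemma colorings_insert_pair:
  "colorings k V E (insert (x, y) R) = {\<kappa> \<in> colorings k V E R. \<kappa> x = \<kappa> y}"
  unfolding colorings_def by auto

text \<open>Since \<open>w\<close> occurs in neither \<open>E\<close> nor \<open>R\<close>, its
  colour is free. Resetting it to \<open>undefined\<close> is restriction to \<open>V\<close> for
  extensional maps.\<close>

lemma mem_colorings_insert_vertex: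
  assumes "\<Union>E \<subseteq> V" "R \<subseteq> V \<times> V" "w \<notin> V"
  shows "\<kappa> \<in> colorings k (insert w V) E R \<longleftrightarrow>
         \<kappa> w < k \<and> \<kappa>(w := undefined) \<in> colorings k V E R"
proof -
  let ?\<kappa> = "\<kappa>(w := undefined)"
  have E: "x \<noteq> w \<and> y \<noteq> w" if "{x, y} \<in> E" for x y using assms that by auto
  have R: "x \<noteq> w \<and> y \<noteq> w" if "(x, y) \<in> R" for x y using assms that by auto
  have "(\<forall>x y. {x, y} \<in> E \<longrightarrow> \<kappa> x \<noteq> \<kappa> y) \<longleftrightarrow> (\<forall>x y. {x, y} \<in> E \<longrightarrow> ?\<kappa> x \<noteq> ?\<kappa> y)"
    by (intro iff_allI imp_cong refl) (auto dest: E)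
  moreover have "(\<forall>(x, y)\<in>R. \<kappa> x = \<kappa> y) \<longleftrightarrow> (\<forall>(x, y)\<in>R. ?\<kappa> x = ?\<kappa> y)"
    by (intro ball_cong refl) (auto dest: R)
  moreover have "\<kappa> \<in> insert w V \<rightarrow>\<^sub>E {..<k} \<longleftrightarrow> \<kappa> w < k \<and> ?\<kappa> \<in> V \<rightarrow>\<^sub>E {..<k}"
    using assms(3) by (auto simp: PiE_iff extensional_def)
  ultimately show ?thesis unfolding colorings_def by blast
qed

lemma fun_upd_mem_colorings:
  assumes "\<kappa> \<in> colorings k V E R" "w \<notin> V"
  shows "\<kappa>(w := undefined) = \<kappa>"
  using assms by (auto simp: colorings_def fun_eq_iff PiE_iff extensional_def)

text \<open>Deletion-contraction, with the contraction expressed by the new pair in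
  \<open>R\<close>.\<close>

lemma card_colorings_insert_edge:
  assumes "finite V"
  shows "of_nat (card (colorings k V (insert {x, y} E) R)) =
         (of_nat (card (colorings k V E R)) - of_nat (card (colorings k V E (insert (x, y) R))) :: rat)"
proof -
  have "colorings k V E R =
        colorings k V (insert {x, y} E) R \<union> colorings k V E (insert (x, y) R)"
    by (auto simp: colorings_insert_edge colorings_insert_pair)
  moreover have "colorings k V (insert {x, y} E) R \<inter> colorings k V E (insert (x, y) R) = {}"
    by (auto simp: colorings_insert_edge colorings_insert_pair)
  ultimately have "card (colorings k V E R) =
      card (colorings k V (insert {x, y} E) R) + card (colorings k V E (insert (x, y) R))"
    using card_Un_disjoint finite_colorings[OF assms] by metis
  then show ?thesis by simp
qed

text \<open>A colouring of \<open>V\<close> extends to \<open>w\<close> by any colour other than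
  that of \<open>u\<close>.\<close>

lemma card_colorings_pendant:
  assumes "finite V" "\<Union>E \<subseteq> V" "R \<subseteq> V \<times> V" "u \<in> V" "w \<notin> V"
  shows "of_nat (card (colorings k (insert w V) (insert {u, w} E) R)) =
         ((of_nat k - 1) * of_nat (card (colorings k V E R)) :: rat)"
proof -
  have uw: "u \<noteq> w" using assms by auto
  note mem = colorings_insert_edge mem_colorings_insert_vertex[OF assms(2,3,5)]
  have "bij_betw (\<lambda>(\<kappa>, c). \<kappa>(w := c))
          (SIGMA \<kappa> : colorings k V E R. {..<k} - {\<kappa> u})
          (colorings k (insert w V) (insert {u, w} E) R)"
    using uw fun_upd_mem_colorings[OF _ assms(5)]
    by (intro bij_betw_byWitness[where f' = "\<lambda>\<kappa>. (\<kappa>(w := undefined), \<kappa> w)"]) (auto simp: mem)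
  then have "card (colorings k (insert w V) (insert {u, w} E) R) =
     card (SIGMA \<kappa> : colorings k V E R. {..<k} - {\<kappa> u})"
    by (simp add: bij_betw_same_card)
  also have "\<dots> = (\<Sum>\<kappa>\<in>colorings k V E R. card ({..<k} - {\<kappa> u}))"
    using finite_colorings[OF assms(1)] by (intro card_SigmaI) auto
  finally have "(of_nat (card (colorings k (insert w V) (insert {u, w} E) R)) :: rat) =
     (\<Sum>\<kappa>\<in>colorings k V E R. of_nat (card ({..<k} - {\<kappa> u})))" by simp
  also have "\<dots> = (\<Sum>\<kappa>\<in>colorings k V E R. of_nat k - 1)"
  proof (rule sum.cong)
    fix \<kappa> assume "\<kappa> \<in> colorings k V E R"
    \<comment> \<open>This also gives \<open>1 \<le> k\<close>, so truncated subtraction on naturals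
      agrees with rational subtraction.\<close>
    then have "\<kappa> u < k" using assms(4) unfolding colorings_def by auto
    then show "(of_nat (card ({..<k} - {\<kappa> u})) :: rat) = of_nat k - 1"
      by (simp add: card_Diff_singleton of_nat_diff)
  qed simp
  finally show ?thesis by simp
qed

text \<open>The colour of \<open>w\<close> is forced to be that of \<open>v\<close>, so the edge
  from \<open>u\<close> to \<open>w\<close> acts as an edge from \<open>u\<close> to
  \<open>v\<close>. For \<open>u = v\<close> both sides are zero.\<close>

lemma card_colorings_pendant_identified:
  assumes "\<Union>E \<subseteq> V" "R \<subseteq> V \<times> V" "u \<in> V" "w \<notin> V" "v \<in> V"
  shows "card (colorings k (insert w V) (insert {u, w} E) (insert (w, v) R)) =
         card (colorings k V (insert {u, v} E) R)"
proof -
  have ne: "u \<noteq> w" "v \<noteq> w" using assms by auto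
  have vk: "\<kappa> v < k" if "\<kappa> \<in> colorings k V E R" for \<kappa>
    using that assms(5) unfolding colorings_def by auto
  note mem = colorings_insert_edge colorings_insert_pair mem_colorings_insert_vertex[OF assms(1,2,4)]
  have "bij_betw (\<lambda>\<kappa>. \<kappa>(w := \<kappa> v))
          (colorings k V (insert {u, v} E) R)
          (colorings k (insert w V) (insert {u, w} E) (insert (w, v) R))"
    using ne vk fun_upd_mem_colorings[OF _ assms(4)]
    by (intro bij_betw_byWitness[where f' = "\<lambda>\<kappa>. \<kappa>(w := undefined)"]) (auto simp: mem)
  then show ?thesis by (simp add: bij_betw_same_card)
qed

text \<open>The sign makes the invariant multiplicative under gluing at a vertex: it is \<open>1\<close> for
  every tree.\<close>

definition has_invariant :: "'a set \<Rightarrow> 'a set set \<Rightarrow> ('a \<times> 'a) set \<Rightarrow> rat \<Rightarrow> bool" where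
  "has_invariant V E R a \<longleftrightarrow> finite V \<and> \<Union>E \<subseteq> V \<and> R \<subseteq> V \<times> V \<and>
     has_lincoeff (\<lambda>k. of_nat (card (colorings k V E R))) ((-1) ^ (card V + 1) * a)"

lemma has_invariant_singleton: "has_invariant {x} {} {} 1"
proof -
  have "colorings k {x} {} {} = {x} \<rightarrow>\<^sub>E {..<k}" for k
    by (simp add: colorings_def)
  moreover have "has_lincoeff of_nat 1"
    unfolding has_lincoeff_def by (intro exI[of _ 1]) simp
  ultimately show ?thesis
    by (simp add: has_invariant_def card_PiE)
qed

lemma has_invariant_insert_refl:
  assumes "has_invariant V E R a" "x \<in> V"
  shows "has_invariant V E (insert (x, x) R) a"
proof -
  have "colorings k V E (insert (x, x) R) = colorings k V E R" for k
    by (simp add: colorings_def)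
  then show ?thesis using assms by (simp add: has_invariant_def)
qed

text \<open>The factor \<open>k - 1\<close> negates the linear coefficient, and the extra vertex
  flips the sign back.\<close>

lemma has_invariant_pendant:
  assumes "has_invariant V E R a" "u \<in> V" "w \<notin> V"
  shows "has_invariant (insert w V) (insert {u, w} E) R a"
proof -
  have "has_lincoeff (\<lambda>k. (of_nat k - 1) * of_nat (card (colorings k V E R)))
          (- ((-1) ^ (card V + 1) * a))"
    using assms(1) by (intro has_lincoeff_pred_mult) (simp add: has_invariant_def)
  then show ?thesis
    using assms card_colorings_pendant[of V E R u w]
    by (auto simp: has_invariant_def)
qed

lemma has_invariant_insert_edge:
  assumes "has_invariant V E R a" "has_invariant V E (insert (x, y) R) b"
  shows "has_invariant V (insert {x, y} E) R (a - b)"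
proof -
  have "has_lincoeff (\<lambda>k. of_nat (card (colorings k V E R))
            - of_nat (card (colorings k V E (insert (x, y) R))))
          ((-1) ^ (card V + 1) * a - (-1) ^ (card V + 1) * b)"
    using assms by (intro has_lincoeff_diff) (simp_all add: has_invariant_def)
  then show ?thesis
    using assms card_colorings_insert_edge[of V _ x y E R]
    by (auto simp: has_invariant_def right_diff_distrib)
qed

text \<open>The count is that of \<open>V\<close> with the edge \<open>{u, v}\<close> added, whose
  invariant is \<open>a - b\<close>. The additional vertex \<open>w\<close> reverses the
  sign.\<close>

lemma has_invariant_pendant_identified:
  assumes "has_invariant V E R a" "has_invariant V E (insert (u, v) R) b" "w \<notin> V"
  shows "has_invariant (insert w V) (insert {u, w} E) (insert (w, v) R) (b - a)"
proof -
  have "u \<in> V" "v \<in> V" using assms(2) by (auto simp: has_invariant_def)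
  moreover have "(- 1) ^ (card V + 1) * (a - b) = (- 1) ^ (card (insert w V) + 1) * (b - a)"
    using assms by (simp add: has_invariant_def algebra_simps)
  ultimately show ?thesis
    using assms(1,3) has_invariant_insert_edge[OF assms(1,2)]
      card_colorings_pendant_identified[of E V R u w v]
    unfolding has_invariant_def by auto
qed


section \<open>Paths and ears\<close>

abbreviation path_edges :: "'a list \<Rightarrow> 'a set set" where
  "path_edges xs \<equiv> edges (path_graph xs)"

lemma path_edges_single [simp]: "path_edges [x] = {}"
  by (simp add: path_graph_def)

lemma path_edges_Cons2: "path_edges (x # y # xs) = insert {x, y} (path_edges (y # xs))"
proof -
  have "{{(x # y # xs) ! i, (x # y # xs) ! Suc i} | i. Suc i < length (x # y # xs)} =
    (\<lambda>i. {(x # y # xs) ! i, (x # y # xs) ! Suc i}) ` {..<Suc (length xs)}" by auto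
  also have "\<dots> = insert {x, y} ((\<lambda>i. {(y # xs) ! i, xs ! i}) ` {..<length xs})"
    unfolding lessThan_Suc_eq_insert_0 by (simp add: image_image)
  finally show ?thesis by (auto simp: path_graph_def)
qed

lemma path_edges_snoc:
  "xs \<noteq> [] \<Longrightarrow> path_edges (xs @ [y]) = insert {last xs, y} (path_edges xs)"
proof (induction xs rule: induct_list012)
  case (3 a b xs)
  then show ?case by (simp add: path_edges_Cons2 insert_commute)
qed (simp_all add: path_edges_Cons2)

text \<open>The wrap-around index selects the appended copy of the head, so a cycle can be treated
  as an ear returning to its start.\<close>

lemma cycle_edges_eq:
  assumes "cs \<noteq> []"
  shows "edges (cycle_graph cs) = path_edges (cs @ [hd cs])"
proof -
  have "{cs ! i, cs ! (Suc i mod length cs)} = {(cs @ [hd cs]) ! i, (cs @ [hd cs]) ! Suc i}"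
    if "i < length cs" for i
    using that assms by (cases "Suc i = length cs") (auto simp: nth_append hd_conv_nth)
  then show ?thesis by (auto simp: cycle_graph_def path_graph_def)
qed

lemma cycle_edges_rotate1: "edges (cycle_graph (rotate1 cs)) = edges (cycle_graph cs)"
\<comment> \<open>This rule separates the empty and one-element lists from lists starting with two
  entries; only there does an edge move from front to back.\<close>
proof (cases cs rule: remdups_adj.cases)
  case (3 x y xs)
  then have "edges (cycle_graph (rotate1 cs)) = path_edges (((y # xs) @ [x]) @ [y])"
    by (simp add: cycle_edges_eq)
  also have "\<dots> = insert {x, y} (path_edges (y # xs @ [x]))"
    by (subst path_edges_snoc) auto
  finally show ?thesis using 3 by (simp add: cycle_edges_eq path_edges_Cons2)
qed simp_all

lemma cycle_graph_rotate: "cycle_graph (rotate i cs) = cycle_graph cs"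
proof -
  have "edges (cycle_graph (rotate i cs)) = edges (cycle_graph cs)"
    by (induction i) (simp_all add: cycle_edges_rotate1)
  then show ?thesis by (simp add: cycle_graph_def)
qed

lemma has_invariant_path:
  assumes "xs \<noteq> []" "distinct xs" "set xs \<inter> V = {hd xs}" "has_invariant V E R a"
  shows "has_invariant (V \<union> set xs) (E \<union> path_edges xs) R a"
  using assms
proof (induction xs rule: rev_nonempty_induct)
  case (single x)
  then have "x \<in> V" by auto
  then show ?case using single by (simp add: insert_absorb)
next
  case (snoc w xs)
  have 1: "has_invariant (V \<union> set xs) (E \<union> path_edges xs) R a"
    using snoc by (intro snoc.IH) auto
  have "w \<notin> V \<union> set xs" using snoc by auto
  then have "has_invariant (insert w (V \<union> set xs)) (insert {last xs, w} (E \<union> path_edges xs)) R a"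
    using snoc by (intro has_invariant_pendant 1) auto
  then show ?case using snoc by (simp add: path_edges_snoc)
qed

text \<open>By \<open>has_invariant_pendant_identified\<close>, each new vertex of the path
  subtracts one more \<open>a\<close>. The start value \<open>b\<close> belongs to the head
  identified with \<open>v\<close>.\<close>

lemma has_invariant_path_identified:
  assumes "xs \<noteq> []" "distinct xs" "set xs \<inter> V = {hd xs}"
    and "has_invariant V E R a" "has_invariant V E (insert (hd xs, v) R) b"
  shows "has_invariant (V \<union> set xs) (E \<union> path_edges xs) (insert (last xs, v) R)
           (b - of_nat (length xs - 1) * a)"
  using assms
proof (induction xs rule: rev_nonempty_induct)
  case (single x)
  then have "x \<in> V" by auto
  then show ?case using single by (simp add: insert_absorb)
next
  case (snoc w xs)
  have 1: "has_invariant (V \<union> set xs) (E \<union> path_edges xs) R a"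
    using snoc by (intro has_invariant_path) auto
  have 2: "has_invariant (V \<union> set xs) (E \<union> path_edges xs) (insert (last xs, v) R)
             (b - of_nat (length xs - 1) * a)"
    using snoc by (intro snoc.IH) auto
  have "w \<notin> V \<union> set xs" using snoc by auto
  from has_invariant_pendant_identified[OF 1 2 this] show ?case
    using snoc by (simp add: path_edges_snoc of_nat_diff Suc_leI algebra_simps)
qed

text \<open>Attach \<open>xs\<close> as a pendant path, then close it with an edge to
  \<open>v\<close> by deletion-contraction. The ear has \<open>length xs\<close> edges because
  \<open>v\<close> is appended; \<open>v\<close> may equal \<open>hd xs\<close>.\<close>

lemma has_invariant_ear:
  assumes "xs \<noteq> []" "distinct xs" "set xs \<inter> V = {hd xs}"
    and "has_invariant V E R a" "has_invariant V E (insert (hd xs, v) R) b"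
  shows "has_invariant (V \<union> set xs) (E \<union> path_edges (xs @ [v])) R (of_nat (length xs) * a - b)"
proof -
  have "a - (b - of_nat (length xs - 1) * a) = of_nat (length xs) * a - b"
    using assms(1) by (simp add: of_nat_diff Suc_leI algebra_simps)
  then show ?thesis
    using has_invariant_insert_edge[OF has_invariant_path[OF assms(1-4)]
        has_invariant_path_identified[OF assms]] path_edges_snoc[OF assms(1), of v]
    by (simp only: Un_insert_right)
qed

text \<open>After rotating the cycle to start at \<open>x\<close>, it is an ear from
  \<open>x\<close> to \<open>x\<close>. Identifying \<open>x\<close> with itself changes nothing, so
  \<open>b = a\<close> in the ear formula.\<close>

lemma has_invariant_closed_ear:
  assumes "distinct cs" "set cs \<inter> V = {x}" "has_invariant V E R a"
  shows "has_invariant (V \<union> set cs) (E \<union> edges (cycle_graph cs)) R ((of_nat (length cs) - 1) * a)"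
proof -
  obtain i where i: "i < length cs" "cs ! i = x"
    using assms(2) by (metis Int_iff in_set_conv_nth singletonI)
  define ds where "ds = rotate i cs"
  have ne: "ds \<noteq> []" using i by (auto simp: ds_def)
  have hd: "hd ds = x" using i by (cases "cs = []") (auto simp: ds_def hd_rotate_conv_nth)
  have "has_invariant (V \<union> set ds) (E \<union> path_edges (ds @ [x])) R (of_nat (length ds) * a - a)"
    using assms ne hd has_invariant_insert_refl[OF assms(3), of x]
    by (intro has_invariant_ear) (auto simp: ds_def)
  moreover have "path_edges (ds @ [x]) = edges (cycle_graph cs)"
    using cycle_edges_eq[OF ne] hd by (simp add: ds_def cycle_graph_rotate)
  ultimately show ?thesis by (simp add: ds_def algebra_simps)
qed


section \<open>Bicyclic graphs\<close>

text \<open>Starting from one vertex with invariant \<open>1\<close>, the first cycle multiplies by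
  \<open>s - 1\<close>, the path by \<open>1\<close>, and the second cycle by
  \<open>t - 1\<close>.\<close>

lemma has_invariant_type_I_form:
  assumes "type_I_form H s t"
  shows "has_invariant (verts H) (edges H) {} ((of_nat s - 1) * (of_nat t - 1))"
proof -
  obtain cs ct ps where d: "distinct cs" "length cs = s" "distinct ct" "length ct = t"
      "distinct ps" "length ps \<ge> 1" "set cs \<inter> set ps = {hd ps}" "set ct \<inter> set ps = {last ps}"
      "set cs \<inter> set ct = (if length ps = 1 then {hd ps} else {})"
    and H: "H = graph_union (graph_union (cycle_graph cs) (cycle_graph ct)) (path_graph ps)"
    and s: "s \<ge> 3"
    using assms unfolding type_I_form_def by blast
  have ne: "ps \<noteq> []" "cs \<noteq> []" using d s by auto
  have 1: "has_invariant ({hd cs} \<union> set cs) ({} \<union> edges (cycle_graph cs)) {}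
             ((of_nat (length cs) - 1) * 1)"
    using d ne by (intro has_invariant_closed_ear has_invariant_singleton) auto
  have 2: "has_invariant (set cs \<union> set ps) (edges (cycle_graph cs) \<union> path_edges ps) {} (of_nat s - 1)"
    using d ne 1 by (intro has_invariant_path) (auto simp: insert_absorb)
  \<comment> \<open>For a one-vertex path the two cycles meet, but only in that vertex.\<close>
  have "set ct \<inter> (set cs \<union> set ps) = {last ps}"
  proof (cases "length ps = 1")
    case True
    then obtain x where "ps = [x]" by (metis One_nat_def length_0_conv length_Suc_conv)
    then show ?thesis using d by auto
  next
    case False
    then show ?thesis using d by auto
  qed
  then have "has_invariant ((set cs \<union> set ps) \<union> set ct)
      ((edges (cycle_graph cs) \<union> path_edges ps) \<union> edges (cycle_graph ct)) {}
      ((of_nat (length ct) - 1) * (of_nat s - 1))"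
    using d 2 by (intro has_invariant_closed_ear) auto
  moreover have "verts H = (set cs \<union> set ps) \<union> set ct"
    "edges H = (edges (cycle_graph cs) \<union> path_edges ps) \<union> edges (cycle_graph ct)"
    by (auto simp: H graph_union_def cycle_graph_def path_graph_def)
  ultimately show ?thesis using d by (simp add: mult.commute)
qed

text \<open>Both ends of \<open>xs\<close> already lie in \<open>V\<close>, so
  \<open>butlast xs\<close> is the part attached as a path and \<open>last xs\<close> is the closing
  vertex of the ear.\<close>

lemma has_invariant_open_ear:
  assumes "distinct xs" "length xs \<ge> 2" "set xs \<inter> V = {hd xs, last xs}"
    and "has_invariant V E R a" "has_invariant V E (insert (hd xs, last xs) R) b"
  shows "has_invariant (V \<union> set xs) (E \<union> path_edges xs) R (of_nat (length xs - 1) * a - b)"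
proof -
  define ys where "ys = butlast xs"
  have "xs \<noteq> []" using assms(2) by auto
  then have xs: "xs = ys @ [last xs]" by (simp add: ys_def)
  have ys: "ys \<noteq> []" using assms(2) by (cases xs) (auto simp: ys_def)
  have hd: "hd xs = hd ys" using xs ys by (metis hd_append2)
  have "distinct (ys @ [last xs])" using assms(1) xs by simp
  then have "distinct ys" "last xs \<notin> set ys" by auto
  moreover have sx: "set xs = insert (last xs) (set ys)" by (subst xs) simp
  moreover have "hd ys \<in> set ys" using ys by simp
  ultimately have "has_invariant (V \<union> set ys) (E \<union> path_edges (ys @ [last xs])) R (of_nat (length ys) * a - b)"
    using assms ys hd by (intro has_invariant_ear) auto
  moreover have "V \<union> set xs = V \<union> set ys" using sx assms(3) by auto
  moreover have "length ys = length xs - 1" by (simp add: ys_def)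
  ultimately show ?thesis using xs by simp
qed

text \<open>Two values are tracked, without and with \<open>u\<close> and \<open>v\<close>
  identified. They are \<open>1\<close> and \<open>1 - k\<close> after \<open>ps\<close>, then
  \<open>l + k - 1\<close> and \<open>(l - 1) * (1 - k)\<close> after \<open>qs\<close>; the ear
  \<open>rs\<close> combines these.\<close>

lemma has_invariant_type_II_form:
  assumes "type_II_form H k l m"
  shows "has_invariant (verts H) (edges H) {}
     (of_nat m * (of_nat l + of_nat k - 1) + (of_nat l - 1) * (of_nat k - 1))"
proof -
  obtain u v ps qs rs where d:
      "distinct ps" "length ps = k + 1" "hd ps = u" "last ps = v"
      "distinct qs" "length qs = l + 1" "hd qs = u" "last qs = v"
      "distinct rs" "length rs = m + 1" "hd rs = u" "last rs = v"
      "set ps \<inter> set qs = {u, v}" "set ps \<inter> set rs = {u, v}" "set qs \<inter> set rs = {u, v}"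
    and H: "H = graph_union (graph_union (path_graph ps) (path_graph qs)) (path_graph rs)"
    and pos: "k \<ge> 1" "l \<ge> 1" "m \<ge> 1"
    using assms unfolding type_II_form_def by blast
  have ne: "ps \<noteq> []" using d by auto
  have hdin: "u \<in> set ps" using ne d(3) by auto
  have "has_invariant ({u} \<union> set ps) ({} \<union> path_edges ps) {} 1"
    using d ne hdin by (intro has_invariant_path has_invariant_singleton) auto
  then have 1: "has_invariant (set ps) (path_edges ps) {} 1"
    using hdin by (simp add: insert_absorb)
  \<comment> \<open>The start value is the trivial identification of \<open>u\<close> with itself,
    which has invariant \<open>1\<close>.\<close>
  have "has_invariant ({u} \<union> set ps) ({} \<union> path_edges ps) (insert (last ps, u) {})
          (1 - of_nat (length ps - 1) * 1)"
    using d ne hdin has_invariant_insert_refl[OF has_invariant_singleton, of u u]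
    by (intro has_invariant_path_identified has_invariant_singleton) auto
  then have 2: "has_invariant (set ps) (path_edges ps) {(v, u)} (1 - of_nat k)"
    using hdin d by (simp add: insert_absorb)
  have sym: "has_invariant V E (insert (u, v) R) a"
    if "has_invariant V E (insert (v, u) R) a" for V E R a
  proof -
    have "colorings k V E (insert (u, v) R) = colorings k V E (insert (v, u) R)" for k
      by (auto simp: colorings_def)
    then show ?thesis using that by (auto simp: has_invariant_def)
  qed
  note 2 = sym[OF 2]
  \<comment> \<open>When \<open>u\<close> and \<open>v\<close> are already identified, the second
    premise of the ear rule inserts the same pair again, so both premises carry the same
    value.\<close>
  have 22: "has_invariant (set ps) (path_edges ps) {(u, v), (u, v)} (1 - of_nat k)"
    using 2 by simp
  have 3: "has_invariant (set ps \<union> set qs) (path_edges ps \<union> path_edges qs) {}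
             (of_nat (length qs - 1) * 1 - (1 - of_nat k))"
    by (rule has_invariant_open_ear) (use d pos 1 2 in auto)
  have 4: "has_invariant (set ps \<union> set qs) (path_edges ps \<union> path_edges qs) {(u, v)}
             (of_nat (length qs - 1) * (1 - of_nat k) - (1 - of_nat k))"
    by (rule has_invariant_open_ear) (use d pos 2 22 in auto)
  have "has_invariant ((set ps \<union> set qs) \<union> set rs) ((path_edges ps \<union> path_edges qs) \<union> path_edges rs) {}
     (of_nat (length rs - 1) * (of_nat (length qs - 1) * 1 - (1 - of_nat k))
        - (of_nat (length qs - 1) * (1 - of_nat k) - (1 - of_nat k)))"
    by (rule has_invariant_open_ear) (use d pos 3 4 in auto)
  moreover have "verts H = (set ps \<union> set qs) \<union> set rs"
    "edges H = (path_edges ps \<union> path_edges qs) \<union> path_edges rs"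
    by (auto simp: H graph_union_def path_graph_def)
  ultimately show ?thesis using d by (simp add: algebra_simps)
qed

section \<open>From the minimal bicyclic subgraph to the whole graph, and stars\<close>

lemma connected_graph_boundary_edge:
  assumes "connected_graph G" "U \<subseteq> verts G" "U \<noteq> {}" "U \<noteq> verts G"
  obtains u w where "u \<in> U" "w \<notin> U" "{u, w} \<in> edges G"
proof -
  obtain x y where xy: "x \<in> U" "y \<in> verts G" "y \<notin> U" using assms by auto
  then have "(x, y) \<in> {(x, y). {x, y} \<in> edges G}\<^sup>*"
    using assms unfolding connected_graph_def by blast
  then have "y \<in> U" if "\<nexists>u w. u \<in> U \<and> w \<notin> U \<and> {u, w} \<in> edges G"
    using that xy(1) by (induction rule: rtrancl_induct) auto
  then show ?thesis using xy that by blast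
qed

lemma finite_edges: "simple_graph G \<Longrightarrow> finite (edges G)"
  unfolding simple_graph_def by (rule finite_subset[of _ "Pow (verts G)"]) auto

text \<open>Equal excess of edges over vertices in both graphs forces the larger one to arise by
  attaching pendant vertices only.\<close>

lemma has_invariant_grow:
  assumes "simple_graph G" "connected_graph G"
    and "U \<subseteq> verts G" "U \<noteq> {}" "F \<subseteq> edges G"
    and "card (edges G) + card U = card F + card (verts G)"
    and "has_invariant U F {} a"
  shows "has_invariant (verts G) (edges G) {} a"
  using assms(3-)
proof (induction "card (verts G - U)" arbitrary: U F)
  case 0
  have fin: "finite (verts G)" using assms(1) by (simp add: simple_graph_def)
  then have U: "U = verts G" using 0(1,2) by auto
  then have "card F = card (edges G)" using "0.prems"(4) by simp
  then have "F = edges G" using card_subset_eq[OF finite_edges[OF assms(1)] "0.prems"(3)] by blast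
  then show ?case using "0.prems"(5) U by simp
next
  case (Suc n)
  have fin: "finite (verts G)" "finite F"
    using assms(1) finite_subset[OF Suc.prems(3) finite_edges] by (simp_all add: simple_graph_def)
  have "finite U" using finite_subset[OF Suc.prems(1) fin(1)] .
  note fin = fin this
  have "U \<noteq> verts G" using Suc.hyps(2) by auto
  then obtain u w where uw: "u \<in> U" "w \<notin> U" "{u, w} \<in> edges G"
    using connected_graph_boundary_edge[OF assms(2) Suc.prems(1,2)] by blast
  then have w: "w \<in> verts G" using assms(1) by (auto simp: simple_graph_def)
  \<comment> \<open>All edges of \<open>F\<close> lie inside \<open>U\<close>, so the edge is new
    and both cardinalities grow by one.\<close>
  have "{u, w} \<notin> F" using Suc.prems(5) uw(2) unfolding has_invariant_def by blast
  show ?case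
  proof (rule Suc.hyps(1)[of "insert w U" "insert {u, w} F"])
    have "verts G - insert w U = (verts G - U) - {w}" by auto
    then show "n = card (verts G - insert w U)" using Suc.hyps(2) uw w fin by simp
    show "has_invariant (insert w U) (insert {u, w} F) {} a"
      using Suc.prems(5) uw(1,2) by (rule has_invariant_pendant)
    show "card (edges G) + card (insert w U) = card (insert {u, w} F) + card (verts G)"
      using Suc.prems(4) fin uw(2) \<open>{u, w} \<notin> F\<close> by simp
    show "insert w U \<subseteq> verts G" using Suc.prems(1) w by simp
    show "insert {u, w} F \<subseteq> edges G" using Suc.prems(3) uw(3) by simp
  qed simp
qed

text \<open>Both graphs have exactly one more edge than vertices, which is the balance required by
  \<open>has_invariant_grow\<close>.\<close>

lemma has_invariant_minimal_bicyclic: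
  assumes "bicyclic G" "minimal_bicyclic_subgraph H G" "has_invariant (verts H) (edges H) {} a"
  shows "has_invariant (verts G) (edges G) {} a"
  using assms
  by (intro has_invariant_grow[of G "verts H" "edges H"])
     (auto simp: minimal_bicyclic_subgraph_def bicyclic_def subgraph_def connected_graph_def)

lemma has_invariant_star:
  assumes "m \<ge> 1"
  shows "has_invariant (verts (star_graph m)) (edges (star_graph m)) {} 1"
  using assms
proof (induction m rule: dec_induct)
  case base
  have "verts (star_graph 1) = {0}" "edges (star_graph 1) = {}" by (auto simp: star_graph_def)
  then show ?case using has_invariant_singleton[of "0::nat"] by simp
next
  case (step m)
  have "verts (star_graph (Suc m)) = insert m (verts (star_graph m))"
    "edges (star_graph (Suc m)) = insert {0, m} (edges (star_graph m))"
    using step by (auto simp: star_graph_def less_Suc_eq)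
  then show ?case using step by (auto simp: star_graph_def intro!: has_invariant_pendant)
qed


section \<open>Specialization to finitely many colours\<close>

definition monomials :: "nat \<Rightarrow> nat \<Rightarrow> nat multiset set" where
  "monomials k n = {M. set_mset M \<subseteq> {..<k} \<and> size M = n}"

text \<open>The degree \<open>n\<close> part of \<open>f\<close> evaluated at \<open>1\<close> in
  the first \<open>k\<close> variables and \<open>0\<close> in the others; fixing the degree keeps
  the sum finite.\<close>

definition specialize :: "nat \<Rightarrow> nat \<Rightarrow> mseries \<Rightarrow> rat" where
  "specialize k n f = (\<Sum>M\<in>monomials k n. f M)"

lemma finite_monomials: "finite (monomials k n)"
proof (rule finite_subset)
  show "monomials k n \<subseteq> mset ` {xs. set xs \<subseteq> {..<k} \<and> length xs = n}"
  proof
    fix M assume "M \<in> monomials k n"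
    moreover obtain xs where "mset xs = M" using ex_mset by blast
    ultimately show "M \<in> mset ` {xs. set xs \<subseteq> {..<k} \<and> length xs = n}"
      by (auto simp: monomials_def)
  qed
qed (simp add: finite_lists_length_eq)

text \<open>Colourings with colours below \<open>k\<close> are grouped by their multiset of
  colours.\<close>

lemma specialize_chromatic:
  assumes "finite (verts G)"
  shows "specialize k (card (verts G)) (chromatic_symmetric_function G) =
         of_nat (card (colorings k (verts G) (edges G) {}))"
proof -
  let ?V = "verts G"
  let ?c = "\<lambda>\<kappa>. image_mset \<kappa> (mset_set ?V)"
  have eq: "{\<kappa> \<in> colorings k ?V (edges G) {}. ?c \<kappa> = M} = {\<kappa> \<in> proper_colorings G. ?c \<kappa> = M}"
    if "M \<in> monomials k (card ?V)" for M
    using that assms unfolding colorings_def proper_colorings_def monomials_def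
    by (fastforce simp: PiE_def Pi_def)
  have sub: "?c ` colorings k ?V (edges G) {} \<subseteq> monomials k (card ?V)"
    using assms by (auto simp: colorings_def monomials_def)
  have "card (colorings k ?V (edges G) {}) =
      (\<Sum>M\<in>monomials k (card ?V). card {\<kappa> \<in> colorings k ?V (edges G) {}. ?c \<kappa> = M})"
    using sum.group[OF finite_colorings[OF assms] finite_monomials sub, of "\<lambda>_. 1::nat"]
    by simp
  also have "\<dots> = (\<Sum>M\<in>monomials k (card ?V). card {\<kappa> \<in> proper_colorings G. ?c \<kappa> = M})"
    using eq by simp
  finally show ?thesis
    by (simp add: specialize_def chromatic_symmetric_function_def)
qed

lemma mseries_mult_nonzero:
  assumes "mseries_mult f g M \<noteq> 0"
  obtains A where "A \<subseteq># M" "f A \<noteq> 0" "g (M - A) \<noteq> 0"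
  using assms unfolding mseries_mult_def
  by (metis (mono_tags, lifting) mem_Collect_eq mult_eq_0_iff sum.neutral)

text \<open>Homogeneity leaves only splittings of a monomial into parts of degrees \<open>a\<close>
  and \<open>b\<close>, and these correspond to pairs \<open>(A, B)\<close> through
  \<open>A + B\<close>.\<close>

lemma specialize_mult:
  assumes f: "\<And>M. f M \<noteq> 0 \<Longrightarrow> size M = a" and g: "\<And>M. g M \<noteq> 0 \<Longrightarrow> size M = b"
  shows "specialize k (a + b) (mseries_mult f g) = specialize k a f * specialize k b g"
proof -
  let ?P = "SIGMA M : monomials k (a + b). {A. A \<subseteq># M}"
  let ?Q = "monomials k a \<times> monomials k b"
  have "specialize k (a + b) (mseries_mult f g) = (\<Sum>(M, A)\<in>?P. f A * g (M - A))"
    unfolding specialize_def mseries_mult_def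
    by (rule sum.Sigma) (auto simp: finite_monomials finite_submultisets)
  also have "\<dots> = (\<Sum>(M, A)\<in>(\<lambda>(A, B). (A + B, A)) ` ?Q. f A * g (M - A))"
  proof (rule sum.mono_neutral_right)
    show "finite ?P" by (auto simp: finite_monomials finite_submultisets)
    show "(\<lambda>(A, B). (A + B, A)) ` ?Q \<subseteq> ?P" by (auto simp: monomials_def)
    show "\<forall>i\<in>?P - (\<lambda>(A, B). (A + B, A)) ` ?Q. (case i of (M, A) \<Rightarrow> f A * g (M - A)) = 0"
    proof safe
      fix M A assume M: "M \<in> monomials k (a + b)" "A \<subseteq># M"
        and n: "(M, A) \<notin> (\<lambda>(A, B). (A + B, A)) ` ?Q"
      show "f A * g (M - A) = 0"
      proof (rule ccontr)
        assume "f A * g (M - A) \<noteq> 0"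
        then have "size A = a" "size (M - A) = b" using f g by auto
        then have "A \<in> monomials k a" "M - A \<in> monomials k b"
          using M set_mset_mono[OF M(2)] by (auto simp: monomials_def dest: in_diffD)
        then have "(M, A) \<in> (\<lambda>(A, B). (A + B, A)) ` ?Q"
          using M(2) by (intro image_eqI[of _ _ "(A, M - A)"]) auto
        then show False using n by simp
      qed
    qed
  qed
  also have "\<dots> = (\<Sum>(A, B)\<in>?Q. f A * g B)"
    by (subst sum.reindex) (auto simp: inj_on_def case_prod_unfold)
  also have "\<dots> = specialize k a f * specialize k b g"
    unfolding specialize_def by (simp add: sum_product sum.cartesian_product)
  finally show ?thesis .
qed

lemma star_sf_nonzero: "star_sf m M \<noteq> 0 \<Longrightarrow> size M = m"
proof -
  assume "star_sf m M \<noteq> 0"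
  then have "{\<kappa> \<in> proper_colorings (star_graph m).
       image_mset \<kappa> (mset_set (verts (star_graph m))) = M} \<noteq> {}"
    unfolding star_sf_def chromatic_symmetric_function_def by (metis card.empty of_nat_0)
  then show "size M = m" by (auto simp: star_graph_def)
qed

lemma star_sf_partition_nonzero: "star_sf_partition \<mu> M \<noteq> 0 \<Longrightarrow> size M = sum_list \<mu>"
proof (induction \<mu> arbitrary: M)
  case Nil
  then show ?case by (auto simp: star_sf_partition_def mseries_one_def split: if_splits)
next
  case (Cons m \<mu>)
  then have "mseries_mult (star_sf m) (star_sf_partition \<mu>) M \<noteq> 0"
    by (simp add: star_sf_partition_def)
  then obtain A where "A \<subseteq># M" "star_sf m A \<noteq> 0" "star_sf_partition \<mu> (M - A) \<noteq> 0"
    by (rule mseries_mult_nonzero)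
  then show ?case using Cons.IH[of "M - A"] star_sf_nonzero[of m A]
    by (metis size_union subset_mset.add_diff_inverse sum_list.Cons)
qed

lemma specialize_star_sf_partition_Cons:
  "specialize k (sum_list (m # \<mu>)) (star_sf_partition (m # \<mu>)) =
   specialize k m (star_sf m) * specialize k (sum_list \<mu>) (star_sf_partition \<mu>)"
  using specialize_mult[of "star_sf m" m "star_sf_partition \<mu>" "sum_list \<mu>" k]
    star_sf_nonzero star_sf_partition_nonzero
  by (simp add: star_sf_partition_def)

lemma specialize_one: "specialize k 0 mseries_one = 1"
proof -
  have "monomials k 0 = {{#}}" by (auto simp: monomials_def)
  then show ?thesis by (simp add: specialize_def mseries_one_def)
qed

section \<open>Linear coefficients of star products and extraction of \<open>c [n]\<close>\<close>

lemma has_lincoeff_star: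
  assumes "m \<ge> 1"
  shows "has_lincoeff (\<lambda>k. specialize k m (star_sf m)) ((-1) ^ (m + 1))"
proof -
  have "specialize k m (star_sf m) =
      of_nat (card (colorings k (verts (star_graph m)) (edges (star_graph m)) {}))" for k
    using specialize_chromatic[of "star_graph m" k] by (simp add: star_sf_def star_graph_def)
  then show ?thesis
    using has_invariant_star[OF assms] by (simp add: has_invariant_def star_graph_def)
qed

lemma has_lincoeff_star_partition:
  assumes "\<mu> \<noteq> []" "0 \<notin> set \<mu>"
  shows "has_lincoeff (\<lambda>k. specialize k (sum_list \<mu>) (star_sf_partition \<mu>))
           (if length \<mu> = 1 then (-1) ^ (sum_list \<mu> + 1) else 0)"
  using assms
proof (induction \<mu> rule: list_nonempty_induct)
  case (single m)
  then show ?case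
    using has_lincoeff_star[of m]
    unfolding specialize_star_sf_partition_Cons
    by (simp add: star_sf_partition_def specialize_one)
next
  case (cons m \<mu>)
  then have "has_lincoeff (\<lambda>k. specialize k m (star_sf m) *
      specialize k (sum_list \<mu>) (star_sf_partition \<mu>)) 0"
    using has_lincoeff_mult[OF has_lincoeff_star[of m]] by auto
  then show ?case using cons unfolding specialize_star_sf_partition_Cons by simp
qed

text \<open>Specializing the star-expansion and comparing linear coefficients leaves only the term
  of \<open>[n]\<close>; its sign matches the one in \<open>has_invariant\<close>.\<close>

lemma star_coefficient_eq_invariant:
  assumes "finite (verts G)" "card (verts G) = n" "n \<ge> 1"
    and X: "chromatic_symmetric_function G =
           (\<lambda>M. \<Sum>\<mu>\<in>partitions n. c \<mu> * star_sf_partition \<mu> M)"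
    and a: "has_invariant (verts G) (edges G) {} a"
  shows "c [n] = a"
proof -
  let ?w = "\<lambda>\<mu>. if length \<mu> = 1 then (-1) ^ (sum_list \<mu> + 1) else (0 :: rat)"
  have "has_lincoeff (\<lambda>k. \<Sum>\<mu>\<in>partitions n. c \<mu> * specialize k n (star_sf_partition \<mu>))
          (\<Sum>\<mu>\<in>partitions n. c \<mu> * ?w \<mu>)"
  proof (intro has_lincoeff_sum has_lincoeff_cmult)
    fix \<mu> assume "\<mu> \<in> partitions n"
    then have "\<mu> \<noteq> []" "0 \<notin> set \<mu>" "sum_list \<mu> = n" using assms(3) by (auto simp: partitions_def)
    then show "has_lincoeff (\<lambda>k. specialize k n (star_sf_partition \<mu>)) (?w \<mu>)"
      using has_lincoeff_star_partition by blast
  qed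
  moreover have "(\<Sum>\<mu>\<in>partitions n. c \<mu> * specialize k n (star_sf_partition \<mu>)) =
      of_nat (card (colorings k (verts G) (edges G) {}))" for k
  proof -
    have "(\<Sum>\<mu>\<in>partitions n. c \<mu> * specialize k n (star_sf_partition \<mu>)) =
        specialize k n (chromatic_symmetric_function G)"
      unfolding X specialize_def sum_distrib_left by (rule sum.swap)
    then show ?thesis using specialize_chromatic[OF assms(1)] assms(2) by simp
  qed
  \<comment> \<open>The only partition of \<open>n\<close> of length one is \<open>[n]\<close>,
    where positivity of \<open>n\<close> makes it a valid partition.\<close>
  moreover have "(\<Sum>\<mu>\<in>partitions n. c \<mu> * ?w \<mu>) = (\<Sum>\<mu>\<in>{[n]}. c \<mu> * ?w \<mu>)"
  proof (rule sum.mono_neutral_right)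
    show "{[n]} \<subseteq> partitions n" using assms(3) by (auto simp: partitions_def)
    show "\<forall>\<mu>\<in>partitions n - {[n]}. c \<mu> * ?w \<mu> = 0"
      by (auto simp: partitions_def length_Suc_conv)
  qed (rule finite_partitions)
  ultimately have "has_lincoeff (\<lambda>k. of_nat (card (colorings k (verts G) (edges G) {})))
      (c [n] * (-1) ^ (n + 1))"
    by simp
  moreover have "has_lincoeff (\<lambda>k. of_nat (card (colorings k (verts G) (edges G) {})))
      ((-1) ^ (n + 1) * a)"
    using a assms(2) by (simp add: has_invariant_def)
  ultimately have "c [n] * (-1) ^ (n + 1) = (-1) ^ (n + 1) * a"
    by (rule has_lincoeff_unique)
  then show ?thesis by simp
qed

lemma of_nat_choose_two: "2 * of_nat (l choose 2) = (of_nat l * (of_nat l - 1) :: rat)"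
proof (cases l)
  case (Suc j)
  have "even (l * (l - 1))" using Suc by simp
  then have "2 * (l choose 2) = l * (l - 1)" unfolding choose_two by (rule dvd_mult_div_cancel)
  then have "(of_nat (2 * (l choose 2)) :: rat) = of_nat (l * (l - 1))" by simp
  then show ?thesis using Suc by (simp add: algebra_simps)
qed simp

theorem proposition7p2:
  fixes G :: "'a ugraph" and n :: nat and c :: "nat list \<Rightarrow> rat"
  assumes "bicyclic G"
    and "card (verts G) = n"
    and "chromatic_symmetric_function G =
           (\<lambda>M. \<Sum>\<mu>\<in>partitions n. c \<mu> * star_sf_partition \<mu> M)"
  shows "(\<forall>s t. s \<ge> 3 \<and> t \<ge> 3 \<and> type_I G s t \<longrightarrow>
            c [n] = (of_nat s - 1) * (of_nat t - 1)) \<and>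
         (\<forall>s t l. s \<ge> 3 \<and> t \<ge> 3 \<and> l \<ge> 1 \<and> type_II G s t l \<longrightarrow>
            c [n] = (of_nat s - 1) * (of_nat t - 1) - 2 * of_nat (l choose 2))"
proof -
  have fin: "finite (verts G)" and "verts G \<noteq> {}"
    using assms(1) by (auto simp: bicyclic_def simple_graph_def connected_graph_def)
  then have "n \<ge> 1" using assms(2) by (auto simp: Suc_le_eq card_gt_0_iff)
  note coeff = star_coefficient_eq_invariant[OF fin assms(2) this assms(3)
      has_invariant_minimal_bicyclic[OF assms(1)]]
  show ?thesis
  proof (intro conjI allI impI; elim conjE)
    fix s t assume "type_I G s t"
    then show "c [n] = (of_nat s - 1) * (of_nat t - 1)"
      using coeff has_invariant_type_I_form unfolding type_I_def by blast
  next
    fix s t l assume "type_II G s t l"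
    then obtain H k m where H: "minimal_bicyclic_subgraph H G" "type_II_form H k l m"
      and st: "s = l + k" "t = l + m" unfolding type_II_def by blast
    have "c [n] = of_nat m * (of_nat l + of_nat k - 1) + (of_nat l - 1) * (of_nat k - 1)"
      using coeff has_invariant_type_II_form H by blast
    \<comment> \<open>The invariant equals \<open>(l + k - 1) * (l + m - 1) - l * (l - 1)\<close>,
      and the last product is twice the binomial coefficient.\<close>
    then show "c [n] = (of_nat s - 1) * (of_nat t - 1) - 2 * of_nat (l choose 2)"
      unfolding of_nat_choose_two st by (simp add: algebra_simps)
  qed
qed

end
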